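(* Let $n\ge1$, let $p\in[-\infty,\infty]$ and let $K,L,C\in\mathcal{K}^n_0$ be such that $\underline{M}_p(K,L)\subset C\subset\overline{M}_p(K,L)$. Then \[ d_{BM}(K,C)\le R_0^{\max}(K,L). \] Moreover, if $K$ is Minkowski centered, $L=-K$, and $C$ is symmetric, then \[ d_{BM}(K,C)=s(K). \]
   Context: $\mathcal{K}^n_0$ denotes the set of compact convex subsets of $\mathbb{R}^n$ containing the origin in their interior. For $C\in\mathcal{K}^n_0$, $h_C(a)=\sup\{a^Tx : x\in C\}$ is the support function and $\|x\|_C=\inf\{\lambda\ge 0 : x\in\lambda C\}$ the gauge function. For $x,y>0$, $m_p(x,y)=\left(\frac{x^p+y^p}{2}\right)^{1/p}$ if $p\in\mathbb{R}\setminus\{0\}$, $m_0(x,y)=\sqrt{xy}$, $m_{-\infty}(x,y)=\min\{x,y\}$, $m_\infty(x,y)=\max\{x,y\}$. $\mathbb{S}_2$ is the Euclidean unit sphere in $\mathbb{R}^n$. For $K,L\in\mathcal{K}^n_0$ and $p\in[-\infty,\infty]$, the upper $p$-mean is \[ \overline{M}_p(K,L)=\{x\in\mathbb{R}^n : a^Tx\le m_p(h_K(a),h_L(a)) \text{ for all } a\in\mathbb{S}_2\}, \] and the lower $p$-mean is \[ \underline{M}_p(K,L)=\mathrm{conv}\left(\left\{m_p(\|v\|_K^{-1},\|v\|_L^{-1})\,v : v\in\mathbb{S}_2\right\}\right). \] The covering radius is $R_0(K,L)=\inf\{\lambda\ge0 : K\subset\lambda L\}$ and $R_0^{\max}(K,L)=\max\{R_0(K,L),R_0(L,K)\}$.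 The circumradius is $R(K,L)=\inf\{\lambda\ge0 : K\subset\lambda L+c,\ c\in\mathbb{R}^n\}$, and the Minkowski asymmetry of $K$ is $s(K)=R(K,-K)$. $K$ is Minkowski centered if $K\subset -s(K)K$. A body $C$ is symmetric if there is $c\in\mathbb{R}^n$ with $C-c=-(C-c)$. The Banach--Mazur distance between full-dimensional compact convex sets is \[ d_{BM}(K,L)=\inf\{\lambda\ge0 : K+c_1\subset AL+c_2\subset\lambda(K+c_1),\ A\in\mathbb{R}^{n\times n}\text{ invertible},\ c_1,c_2\in\mathbb{R}^n\}. \] *)

theory Defs
  imports "HOL-Analysis.Analysis"
begin

(* The real-valued Inf and Sup below are unspecified on empty or unbounded sets. For bodies
   containing the origin in their interior, every set they are applied to is nonempty and
   bounded on the relevant side. *)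

definition bodies0 :: "'a::euclidean_space set set" where
  "bodies0 = {C. compact C \<and> convex C \<and> 0 \<in> interior C}"

definition support_function :: "'a::euclidean_space set \<Rightarrow> 'a \<Rightarrow> real" where
  "support_function C a = (SUP x\<in>C. a \<bullet> x)"

definition gauge_function :: "'a::euclidean_space set \<Rightarrow> 'a \<Rightarrow> real" where
  "gauge_function C x = Inf {r. r \<ge> 0 \<and> x \<in> (*\<^sub>R) r ` C}"

(* Only meant for x, y > 0. *)
definition pmean :: "ereal \<Rightarrow> real \<Rightarrow> real \<Rightarrow> real" where
  "pmean p x y =
     (if p = \<infinity> then max x y
      else if p = - \<infinity> then min x y
      else if p = 0 then sqrt (x * y)
      else let r = real_of_ereal p in ((x powr r + y powr r) / 2) powr (1 / r))"

definition upper_mean :: "ereal \<Rightarrow> 'a::euclidean_space set \<Rightarrow> 'a set \<Rightarrow> 'a set" where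
  "upper_mean p K L =
     {x. \<forall>a\<in>sphere 0 1. a \<bullet> x \<le> pmean p (support_function K a) (support_function L a)}"

definition lower_mean :: "ereal \<Rightarrow> 'a::euclidean_space set \<Rightarrow> 'a set \<Rightarrow> 'a set" where
  "lower_mean p K L =
     convex hull
       ((\<lambda>v. pmean p (inverse (gauge_function K v)) (inverse (gauge_function L v)) *\<^sub>R v)
          ` sphere 0 1)"

definition covering_radius :: "'a::euclidean_space set \<Rightarrow> 'a set \<Rightarrow> real" where
  "covering_radius K L = Inf {r. r \<ge> 0 \<and> K \<subseteq> (*\<^sub>R) r ` L}"

definition max_covering_radius :: "'a::euclidean_space set \<Rightarrow> 'a set \<Rightarrow> real" where
  "max_covering_radius K L = max (covering_radius K L) (covering_radius L K)"

definition circumradius :: "'a::euclidean_space set \<Rightarrow> 'a set \<Rightarrow> real" where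
  "circumradius K L = Inf {r. r \<ge> 0 \<and> (\<exists>c. K \<subseteq> (+) c ` (*\<^sub>R) r ` L)}"

definition minkowski_asymmetry :: "'a::euclidean_space set \<Rightarrow> real" where
  "minkowski_asymmetry K = circumradius K (uminus ` K)"

definition minkowski_centered :: "'a::euclidean_space set \<Rightarrow> bool" where
  "minkowski_centered K \<longleftrightarrow> K \<subseteq> (*\<^sub>R) (- minkowski_asymmetry K) ` K"

definition symmetric_body :: "'a::euclidean_space set \<Rightarrow> bool" where
  "symmetric_body C \<longleftrightarrow> (\<exists>c. (\<lambda>x. x - c) ` C = uminus ` (\<lambda>x. x - c) ` C)"

definition banach_mazur :: "(real ^ 'n) set \<Rightarrow> (real ^ 'n) set \<Rightarrow> real" where
  "banach_mazur K L =
     Inf {r. r \<ge> 0 \<and>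
       (\<exists>(A :: real ^ 'n ^ 'n) c1 c2. invertible A \<and>
          (+) c1 ` K \<subseteq> (+) c2 ` (*v) A ` L \<and>
          (+) c2 ` (*v) A ` L \<subseteq> (*\<^sub>R) r ` (+) c1 ` K)}"

end

theory Submission
  imports Defs
begin

text \<open>
  Both parts come down to one scalar identity for the means. Suppose \<open>R > 0\<close> satisfies
  \<open>K \<subseteq> R L\<close> and \<open>L \<subseteq> R K\<close>, and put \<open>m = pmean p 1 (1 / R)\<close>. The means are monotone and
  positively homogeneous. Hence \<open>h\<^sub>L \<le> R h\<^sub>K\<close> bounds the upper mean by \<open>pmean p 1 R\<close> times \<open>K\<close>
  (\<open>upper_mean_subset_scaled\<close>), and the comparison \<open>\<parallel>v\<parallel>\<^sub>L \<le> R \<parallel>v\<parallel>\<^sub>K\<close> of the gauges makes every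
  body that contains the lower mean contain \<open>m K\<close> (\<open>scaled_subset_of_lower_mean\<close>). Homogeneity
  and symmetry of the mean give \<open>pmean p 1 R = R m\<close>, whatever \<open>p\<close> is. So
  \<open>K \<subseteq> (1 / m) C \<subseteq> R K\<close>, which is a Banach-Mazur position with ratio \<open>R\<close>. Every \<open>R\<close> above
  the larger covering radius qualifies, which gives the inequality.

  If \<open>K\<close> is Minkowski centered and \<open>L = - K\<close>, then both covering radii are at most \<open>s(K)\<close>. For
  the converse bound, a symmetric body \<open>D\<close> with \<open>K + c\<^sub>1 \<subseteq> D \<subseteq> r (K + c\<^sub>1)\<close> equals a translate
  of \<open>- D\<close>, so \<open>K\<close> lies in a translate of \<open>- r K\<close>; this forces \<open>s(K) \<le> r\<close>
  (\<open>minkowski_asymmetry_le_ratio\<close>).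
\<close>

section \<open>Power means\<close>

lemma pmean_commute: "pmean p x y = pmean p y x"
  by (simp add: pmean_def max.commute min.commute mult.commute add.commute Let_def)

lemma pmean_pos:
  assumes "0 < x" "0 < y"
  shows "0 < pmean p x y"
proof -
  have "0 < x powr r + y powr r" for r
    using assms by (intro add_pos_pos) auto
  then show ?thesis
    using assms by (auto simp: pmean_def Let_def less_le)
qed

lemma pmean_mult:
  assumes "0 < c" "0 < x" "0 < y"
  shows "pmean p (c * x) (c * y) = c * pmean p x y"
proof -
  consider "p = \<infinity>" | "p = - \<infinity>" | "p = 0" | r where "p = ereal r" "r \<noteq> 0"
    by (cases p) auto
  then show ?thesis
  proof cases
    case 1
    then show ?thesis using assms by (simp add: pmean_def max_mult_distrib_left)
  next
    case 2
    then show ?thesis using assms by (simp add: pmean_def min_mult_distrib_left)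
  next
    case 3
    have "sqrt (c * x * (c * y)) = sqrt (c\<^sup>2 * (x * y))"
      by (simp add: power2_eq_square algebra_simps)
    then show ?thesis using 3 assms by (simp add: pmean_def real_sqrt_mult)
  next
    case 4
    have "((c * x) powr r + (c * y) powr r) / 2 = c powr r * ((x powr r + y powr r) / 2)"
      using assms by (simp add: powr_mult algebra_simps add_divide_distrib)
    moreover have "(c powr r * M) powr (1 / r) = c * M powr (1 / r)" if "0 \<le> M" for M
      using assms(1) 4(2) that by (simp add: powr_mult powr_powr)
    moreover have "0 \<le> (x powr r + y powr r) / 2" by simp
    ultimately have "(((c * x) powr r + (c * y) powr r) / 2) powr (1 / r)
        = c * ((x powr r + y powr r) / 2) powr (1 / r)"
      by metis
    then show ?thesis using 4 by (simp add: pmean_def)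
  qed
qed

lemma pmean_mono:
  assumes "0 < x" "0 < y" "x \<le> x'" "y \<le> y'"
  shows "pmean p x y \<le> pmean p x' y'"
proof -
  consider "p = \<infinity>" | "p = - \<infinity>" | "p = 0" | r where "p = ereal r" "r \<noteq> 0"
    by (cases p) auto
  then show ?thesis
  proof cases
    case 1
    then show ?thesis using assms by (auto simp: pmean_def)
  next
    case 2
    then show ?thesis using assms by (auto simp: pmean_def)
  next
    case 3
    then show ?thesis using assms by (auto simp: pmean_def intro!: mult_mono)
  next
    case (4 r)
    show ?thesis
    proof (cases "r > 0")
      case True
      have "x powr r + y powr r \<le> x' powr r + y' powr r"
        using assms True by (intro add_mono powr_mono2) auto
      then have "((x powr r + y powr r) / 2) powr (1 / r)
          \<le> ((x' powr r + y' powr r) / 2) powr (1 / r)"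
        using True by (intro powr_mono2) auto
      then show ?thesis using 4 by (simp add: pmean_def)
    next
      \<comment> \<open>Both the inner and the outer power reverse the order.\<close>
      case False
      with 4 have neg: "r < 0" by simp
      have le: "x' powr r + y' powr r \<le> x powr r + y powr r"
        using assms neg by (intro add_mono powr_mono2') auto
      have "0 < x' powr r + y' powr r"
        using assms by (intro add_pos_pos) auto
      then have "((x powr r + y powr r) / 2) powr (1 / r)
          \<le> ((x' powr r + y' powr r) / 2) powr (1 / r)"
        using neg le by (intro powr_mono2') auto
      then show ?thesis using 4 by (simp add: pmean_def)
    qed
  qed
qed

text \<open>The identity that turns two one-sided estimates into the ratio \<open>R\<close>, for every \<open>p\<close>.\<close>

lemma pmean_one_reciprocal:
  assumes "0 < R"
  shows "pmean p 1 R = R * pmean p 1 (1 / R)"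
proof -
  have "R * pmean p 1 (1 / R) = pmean p (R * 1) (R * (1 / R))"
    using assms by (intro pmean_mult [symmetric]) auto
  also have "\<dots> = pmean p 1 R"
    using assms by (simp add: pmean_commute)
  finally show ?thesis by simp
qed

section \<open>Bodies, support functions and gauges\<close>

lemma scaleR_mem_convex:
  assumes "convex K" "0 \<in> K" "x \<in> K" "0 \<le> t" "t \<le> 1"
  shows "t *\<^sub>R x \<in> K"
  using convexD_alt [of K 0 x t] assms by simp

lemma scaled_subset_mono:
  assumes "convex L" "0 \<in> L" "0 \<le> r" "r \<le> R"
  shows "(*\<^sub>R) r ` L \<subseteq> (*\<^sub>R) R ` L"
proof (cases "R = 0")
  case True
  then show ?thesis using assms by auto
next
  case False
  then have R: "R > 0" using assms by simp
  show ?thesis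
  proof
    fix y assume "y \<in> (*\<^sub>R) r ` L"
    then obtain x where x: "x \<in> L" "y = r *\<^sub>R x" by auto
    have "(r / R) *\<^sub>R x \<in> L"
      using assms x R by (intro scaleR_mem_convex) auto
    moreover have "y = R *\<^sub>R ((r / R) *\<^sub>R x)" using x R by simp
    ultimately show "y \<in> (*\<^sub>R) R ` L" by blast
  qed
qed

lemma bodies0_zero_mem: "K \<in> bodies0 \<Longrightarrow> 0 \<in> K"
  using interior_subset by (auto simp: bodies0_def)

lemma bodies0_cball:
  assumes "K \<in> bodies0"
  obtains e where "0 < e" "cball 0 e \<subseteq> K"
  using assms by (auto simp: bodies0_def mem_interior_cball)

lemma bodies0_bounded:
  assumes "K \<in> bodies0"
  obtains B where "0 < B" "\<And>x. x \<in> K \<Longrightarrow> norm x \<le> B"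
  using assms compact_imp_bounded [of K] by (auto simp: bodies0_def bounded_pos)

lemma bounded_subset_scaled_body:
  assumes "L \<in> bodies0" "bounded S"
  obtains r where "0 < r" "S \<subseteq> (*\<^sub>R) r ` L"
proof -
  obtain e where e: "0 < e" "cball 0 e \<subseteq> L" using bodies0_cball [OF assms(1)] by metis
  obtain B where B: "0 < B" "\<And>x. x \<in> S \<Longrightarrow> norm x \<le> B"
    using assms(2) by (auto simp: bounded_pos)
  have "S \<subseteq> (*\<^sub>R) (B / e) ` L"
  proof
    fix x assume "x \<in> S"
    then have "(e / B) *\<^sub>R x \<in> cball 0 e"
      using B e by (simp add: field_simps)
    moreover have "x = (B / e) *\<^sub>R ((e / B) *\<^sub>R x)" using B e by simp
    ultimately show "x \<in> (*\<^sub>R) (B / e) ` L" using e by blast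
  qed
  then show ?thesis using that [of "B / e"] e B by simp
qed

lemma inner_le_support_function:
  assumes "bounded K" "x \<in> K"
  shows "a \<bullet> x \<le> support_function K a"
proof -
  obtain B where B: "\<And>x. x \<in> K \<Longrightarrow> norm x \<le> B"
    using assms(1) by (auto simp: bounded_iff)
  have "bdd_above ((\<lambda>x. a \<bullet> x) ` K)"
  proof (rule bdd_aboveI2)
    fix x assume "x \<in> K"
    have "a \<bullet> x \<le> norm a * norm x" by (rule norm_cauchy_schwarz)
    also have "\<dots> \<le> norm a * B" using B \<open>x \<in> K\<close> by (intro mult_left_mono) auto
    finally show "a \<bullet> x \<le> norm a * B" .
  qed
  then show ?thesis unfolding support_function_def using assms(2) by (intro cSUP_upper)
qed

lemma support_function_pos:
  assumes "K \<in> bodies0" "a \<noteq> 0"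
  shows "0 < support_function K a"
proof -
  obtain e where e: "0 < e" "cball 0 e \<subseteq> K" using bodies0_cball [OF assms(1)] by metis
  have "(e / norm a) *\<^sub>R a \<in> K" using e assms by (intro subsetD [OF e(2)]) auto
  then have "a \<bullet> ((e / norm a) *\<^sub>R a) \<le> support_function K a"
    using assms by (intro inner_le_support_function) (auto simp: bodies0_def compact_imp_bounded)
  moreover have "0 < a \<bullet> ((e / norm a) *\<^sub>R a)" using e assms by simp
  ultimately show ?thesis by linarith
qed

lemma support_function_le_scaled:
  assumes "bounded K" "L \<noteq> {}" "0 \<le> R" "L \<subseteq> (*\<^sub>R) R ` K"
  shows "support_function L a \<le> R * support_function K a"
  unfolding support_function_def [of L]
proof (rule cSUP_least [OF assms(2)])
  fix x assume "x \<in> L"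
  then obtain y where y: "y \<in> K" "x = R *\<^sub>R y" using assms(4) by auto
  then show "a \<bullet> x \<le> R * support_function K a"
    using inner_le_support_function [OF assms(1) y(1), of a] assms(3)
    by (simp add: mult_left_mono)
qed

text \<open>A point outside a closed convex set is cut off by a hyperplane; normalising its normal
  vector produces a unit direction in which the support inequality fails.\<close>

lemma mem_if_inner_le_support_function:
  assumes "convex K" "closed K" "K \<noteq> {}"
    and le: "\<And>a. a \<in> sphere 0 1 \<Longrightarrow> a \<bullet> x \<le> support_function K a"
  shows "x \<in> K"
proof (rule ccontr)
  assume "x \<notin> K"
  then obtain a b where ab: "a \<bullet> x < b" "\<And>y. y \<in> K \<Longrightarrow> b < a \<bullet> y"
    using separating_hyperplane_closed_point [OF assms(1,2)] by blast
  have "a \<noteq> 0" using ab assms(3) by force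
  define u where "u = (- 1 / norm a) *\<^sub>R a"
  have "support_function K u \<le> - b / norm a"
    unfolding support_function_def
  proof (rule cSUP_least [OF assms(3)])
    fix y assume "y \<in> K"
    then show "u \<bullet> y \<le> - b / norm a"
      using ab(2) [of y] \<open>a \<noteq> 0\<close> by (simp add: u_def divide_right_mono)
  qed
  moreover have "- b / norm a < u \<bullet> x"
    using ab(1) \<open>a \<noteq> 0\<close> by (simp add: u_def divide_strict_right_mono)
  moreover have "u \<in> sphere 0 1" using \<open>a \<noteq> 0\<close> by (simp add: u_def)
  ultimately show False using le [of u] by linarith
qed

lemma gauge_function_le:
  assumes "0 \<le> r" "x \<in> (*\<^sub>R) r ` K"
  shows "gauge_function K x \<le> r"
  unfolding gauge_function_def using assms by (intro cInf_lower bdd_belowI [of _ 0]) auto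

lemma le_gauge_function:
  assumes "K \<in> bodies0" "\<And>r. 0 \<le> r \<Longrightarrow> x \<in> (*\<^sub>R) r ` K \<Longrightarrow> c \<le> r"
  shows "c \<le> gauge_function K x"
proof -
  obtain r where "0 < r" "{x} \<subseteq> (*\<^sub>R) r ` K"
    using bounded_subset_scaled_body [OF assms(1), of "{x}"] by auto
  then have "{r. r \<ge> 0 \<and> x \<in> (*\<^sub>R) r ` K} \<noteq> {}"
    by (auto intro: less_imp_le)
  then show ?thesis unfolding gauge_function_def using assms(2) by (intro cInf_greatest) auto
qed

lemma gauge_function_pos:
  assumes "K \<in> bodies0" "x \<noteq> 0"
  shows "0 < gauge_function K x"
proof -
  obtain B where B: "0 < B" "\<And>x. x \<in> K \<Longrightarrow> norm x \<le> B" using bodies0_bounded [OF assms(1)] by metis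
  have "norm x / B \<le> gauge_function K x"
  proof (rule le_gauge_function [OF assms(1)])
    fix r :: real assume r: "0 \<le> r" "x \<in> (*\<^sub>R) r ` K"
    then obtain y where "y \<in> K" "x = r *\<^sub>R y" by auto
    then have "norm x \<le> r * B" using B(2) [of y] r by (simp add: mult_left_mono)
    then show "norm x / B \<le> r" using B by (simp add: field_simps)
  qed
  moreover have "0 < norm x / B" using assms B by simp
  ultimately show ?thesis by linarith
qed

lemma gauge_function_le_scaled:
  assumes "K \<in> bodies0" "0 < R" "K \<subseteq> (*\<^sub>R) R ` L"
  shows "gauge_function L x \<le> R * gauge_function K x"
proof -
  have "gauge_function L x / R \<le> gauge_function K x"
  proof (rule le_gauge_function [OF assms(1)])
    fix r :: real assume r: "0 \<le> r" "x \<in> (*\<^sub>R) r ` K"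
    then obtain y where "y \<in> K" "x = r *\<^sub>R y" by auto
    then obtain z where "z \<in> L" "x = (r * R) *\<^sub>R z" using assms(3) by auto
    then have "gauge_function L x \<le> r * R"
      using r assms by (intro gauge_function_le) auto
    then show "gauge_function L x / R \<le> r" using assms by (simp add: field_simps)
  qed
  then show ?thesis using assms by (simp add: field_simps)
qed

section \<open>Inclusions between the means and multiples of the body\<close>

lemma upper_mean_subset_scaled:
  assumes K: "K \<in> bodies0" and L: "L \<in> bodies0" and R: "0 < R" and "L \<subseteq> (*\<^sub>R) R ` K"
  shows "upper_mean p K L \<subseteq> (*\<^sub>R) (pmean p 1 R) ` K"
proof
  fix x assume x: "x \<in> upper_mean p K L"
  define M where "M = pmean p 1 R"
  have M: "0 < M" unfolding M_def using R by (intro pmean_pos) auto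
  have "(1 / M) *\<^sub>R x \<in> K"
  proof (rule mem_if_inner_le_support_function)
    show "convex K" "closed K" "K \<noteq> {}"
      using K bodies0_zero_mem [OF K] by (auto simp: bodies0_def compact_imp_closed)
    fix a :: 'a assume a: "a \<in> sphere 0 1"
    then have "a \<noteq> 0" by auto
    have hK: "0 < support_function K a" and hL: "0 < support_function L a"
      using support_function_pos K L \<open>a \<noteq> 0\<close> by blast+
    have "a \<bullet> x \<le> pmean p (support_function K a) (support_function L a)"
      using x a by (simp add: upper_mean_def)
    also have "\<dots> \<le> pmean p (support_function K a * 1) (support_function K a * R)"
    proof (rule pmean_mono [OF hK hL])
      have "support_function L a \<le> R * support_function K a"
        using assms bodies0_zero_mem [OF L]
        by (intro support_function_le_scaled) (auto simp: bodies0_def compact_imp_bounded)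
      then show "support_function L a \<le> support_function K a * R" by (simp add: mult.commute)
    qed simp
    also have "\<dots> = support_function K a * M"
      unfolding M_def using hK R by (intro pmean_mult) auto
    finally show "a \<bullet> (1 / M) *\<^sub>R x \<le> support_function K a"
      using M by (simp add: field_simps)
  qed
  moreover have "x = M *\<^sub>R ((1 / M) *\<^sub>R x)" using M by simp
  ultimately show "x \<in> (*\<^sub>R) (pmean p 1 R) ` K" unfolding M_def by blast
qed

text \<open>Along each ray, the generating point of the lower mean lies at least as far out as
  \<open>pmean p 1 (1 / R)\<close> times the radial extent of \<open>K\<close>. The convex body \<open>C\<close> contains this point and
  the origin, hence the whole segment between them.\<close>

lemma scaled_subset_of_lower_mean:
  assumes K: "K \<in> bodies0" and L: "L \<in> bodies0" and C: "convex C" "0 \<in> C"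
    and R: "0 < R" and KL: "K \<subseteq> (*\<^sub>R) R ` L" and low: "lower_mean p K L \<subseteq> C"
  shows "(*\<^sub>R) (pmean p 1 (1 / R)) ` K \<subseteq> C"
proof
  define m where "m = pmean p 1 (1 / R)"
  have m: "0 < m" unfolding m_def using R by (intro pmean_pos) auto
  fix y assume "y \<in> (*\<^sub>R) (pmean p 1 (1 / R)) ` K"
  then obtain x where x: "x \<in> K" "y = m *\<^sub>R x" by (auto simp: m_def)
  show "y \<in> C"
  proof (cases "x = 0")
    case True
    then show ?thesis using x C by simp
  next
    case False
    define v where "v = (1 / norm x) *\<^sub>R x"
    have v: "v \<in> sphere 0 1" and xv: "x = norm x *\<^sub>R v" using False by (simp_all add: v_def)
    have "v \<noteq> 0" using False by (simp add: v_def)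
    define k where "k = inverse (gauge_function K v)"
    define l where "l = inverse (gauge_function L v)"
    have gK: "0 < gauge_function K v" and gL: "0 < gauge_function L v"
      using gauge_function_pos K L \<open>v \<noteq> 0\<close> by blast+
    then have k: "0 < k" and l: "0 < l" by (simp_all add: k_def l_def)
    have "gauge_function K v \<le> 1 / norm x"
      using x(1) by (intro gauge_function_le) (auto simp: v_def)
    then have nk: "norm x \<le> k" using gK False by (simp add: k_def field_simps)
    have "gauge_function L v \<le> R * gauge_function K v"
      by (rule gauge_function_le_scaled [OF K R KL])
    then have kl: "k * (1 / R) \<le> l" using gK gL R by (simp add: k_def l_def field_simps)
    have "norm x * m \<le> k * m" using nk m by (simp add: mult_right_mono)
    also have "\<dots> = pmean p (k * 1) (k * (1 / R))"
      unfolding m_def using k R by (intro pmean_mult [symmetric]) auto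
    also have "\<dots> \<le> pmean p k l" using k l kl R by (intro pmean_mono) auto
    finally have le: "norm x * m \<le> pmean p k l" .
    have P: "0 < pmean p k l" using k l by (rule pmean_pos)
    have "pmean p k l *\<^sub>R v \<in> lower_mean p K L"
      unfolding lower_mean_def k_def l_def by (intro hull_inc imageI v)
    then have "pmean p k l *\<^sub>R v \<in> C" using low by blast
    then have "(norm x * m / pmean p k l) *\<^sub>R (pmean p k l *\<^sub>R v) \<in> C"
      using le P m by (intro scaleR_mem_convex [OF C \<open>pmean p k l *\<^sub>R v \<in> C\<close>]) auto
    moreover have "y = (norm x * m / pmean p k l) *\<^sub>R (pmean p k l *\<^sub>R v)"
      using P x(2) False by (simp add: v_def)
    ultimately show ?thesis by simp
  qed
qed

section \<open>Covering radii and the Banach-Mazur distance\<close>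

lemma covering_factors_nonempty:
  assumes "bounded K" "L \<in> bodies0"
  shows "{r. r \<ge> 0 \<and> K \<subseteq> (*\<^sub>R) r ` L} \<noteq> {}"
proof -
  obtain r0 where "0 < r0" "K \<subseteq> (*\<^sub>R) r0 ` L"
    using bounded_subset_scaled_body [OF assms(2,1)] .
  then show ?thesis
    by (auto intro: less_imp_le)
qed

text \<open>Working with factors strictly above the covering radius avoids having to show that the
  infimum is attained.\<close>

lemma subset_scaled_if_covering_radius_less:
  assumes "bounded K" "L \<in> bodies0" "covering_radius K L < R"
  shows "K \<subseteq> (*\<^sub>R) R ` L"
proof -
  obtain r where r: "0 \<le> r" "K \<subseteq> (*\<^sub>R) r ` L" "r < R"
    using cInf_lessD [OF covering_factors_nonempty [OF assms(1,2)]] assms(3)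
    unfolding covering_radius_def by blast
  have "(*\<^sub>R) r ` L \<subseteq> (*\<^sub>R) R ` L"
    using assms(2) bodies0_zero_mem [OF assms(2)] r
    by (intro scaled_subset_mono) (auto simp: bodies0_def)
  then show ?thesis using r by blast
qed

lemma covering_radius_le:
  assumes "0 \<le> r" "K \<subseteq> (*\<^sub>R) r ` L"
  shows "covering_radius K L \<le> r"
  unfolding covering_radius_def using assms by (intro cInf_lower bdd_belowI [of _ 0]) auto

lemma covering_radius_nonneg:
  assumes "bounded K" "L \<in> bodies0"
  shows "0 \<le> covering_radius K L"
  unfolding covering_radius_def
  using covering_factors_nonempty [OF assms] by (intro cInf_greatest) auto

definition banach_mazur_position ::
    "(real ^ 'n) set \<Rightarrow> (real ^ 'n) set \<Rightarrow> real \<Rightarrow> bool" where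
  "banach_mazur_position K L r \<longleftrightarrow> r \<ge> 0 \<and>
     (\<exists>(A :: real ^ 'n ^ 'n) c1 c2. invertible A \<and>
        (+) c1 ` K \<subseteq> (+) c2 ` (*v) A ` L \<and>
        (+) c2 ` (*v) A ` L \<subseteq> (*\<^sub>R) r ` (+) c1 ` K)"

lemma banach_mazur_eq_Inf: "banach_mazur K L = Inf {r. banach_mazur_position K L r}"
  by (simp add: banach_mazur_def banach_mazur_position_def)

lemma banach_mazur_le: "banach_mazur_position K L r \<Longrightarrow> banach_mazur K L \<le> r"
  unfolding banach_mazur_eq_Inf
  by (intro cInf_lower bdd_belowI [of _ 0]) (auto simp: banach_mazur_position_def)

lemma banach_mazur_position_scaled:
  fixes K C :: "(real ^ 'n) set"
  assumes "0 < m" "0 \<le> r" "(*\<^sub>R) m ` K \<subseteq> C" "C \<subseteq> (*\<^sub>R) (r * m) ` K"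
  shows "banach_mazur_position K C r"
proof -
  define A :: "real ^ 'n ^ 'n" where "A = (1 / m) *\<^sub>R mat 1"
  have A: "A *v x = (1 / m) *\<^sub>R x" for x
    by (simp add: A_def flip: scaleR_matrix_vector_assoc)
  have "invertible A"
    unfolding A_def using assms by (intro scalar_invertible) (auto simp: invertible_def)
  moreover have "K \<subseteq> (*v) A ` C"
  proof
    fix x assume "x \<in> K"
    then have "m *\<^sub>R x \<in> C" using assms by blast
    moreover have "x = A *v (m *\<^sub>R x)" using assms by (simp add: A)
    ultimately show "x \<in> (*v) A ` C" by blast
  qed
  moreover have "(*v) A ` C \<subseteq> (*\<^sub>R) r ` K"
  proof
    fix y assume "y \<in> (*v) A ` C"
    then obtain x where "x \<in> K" "y = A *v ((r * m) *\<^sub>R x)" using assms(4) by auto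
    moreover from this have "y = r *\<^sub>R x" using assms by (simp add: A)
    ultimately show "y \<in> (*\<^sub>R) r ` K" by blast
  qed
  ultimately show ?thesis
    unfolding banach_mazur_position_def using assms(2)
    by (intro conjI exI [of _ A] exI [of _ 0]) (simp_all only: image_add_0)
qed

lemma banach_mazur_position_between_means:
  fixes K L C :: "(real ^ 'n) set"
  assumes "K \<in> bodies0" "L \<in> bodies0" "C \<in> bodies0"
    and "lower_mean p K L \<subseteq> C" "C \<subseteq> upper_mean p K L"
    and R: "max_covering_radius K L < R"
  shows "banach_mazur_position K C R"
proof -
  have bdd: "bounded K" "bounded L"
    using assms by (auto simp: bodies0_def compact_imp_bounded)
  have KL: "K \<subseteq> (*\<^sub>R) R ` L" and LK: "L \<subseteq> (*\<^sub>R) R ` K"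
    using subset_scaled_if_covering_radius_less [OF bdd(1) assms(2), of R]
      subset_scaled_if_covering_radius_less [OF bdd(2) assms(1), of R] R
    by (simp_all add: max_covering_radius_def)
  have "0 < R"
    using R covering_radius_nonneg [OF bdd(1) assms(2)] by (simp add: max_covering_radius_def)
  show ?thesis
  proof (rule banach_mazur_position_scaled)
    show "0 < pmean p 1 (1 / R)" "0 \<le> R" using \<open>0 < R\<close> by (auto intro: pmean_pos)
    show "(*\<^sub>R) (pmean p 1 (1 / R)) ` K \<subseteq> C"
      using assms bodies0_zero_mem [OF assms(3)] \<open>0 < R\<close> KL
      by (intro scaled_subset_of_lower_mean) (auto simp: bodies0_def)
    show "C \<subseteq> (*\<^sub>R) (R * pmean p 1 (1 / R)) ` K"
      using upper_mean_subset_scaled [OF assms(1,2) \<open>0 < R\<close> LK, of p] assms(5)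
      unfolding pmean_one_reciprocal [OF \<open>0 < R\<close>] by blast
  qed
qed

section \<open>Minkowski asymmetry\<close>

text \<open>If \<open>K + c\<^sub>1 \<subseteq> D \<subseteq> r (K + c\<^sub>1)\<close> with \<open>D = A C + c\<^sub>2\<close> symmetric, reflecting \<open>D\<close> in its center
  sends each point of \<open>K + c\<^sub>1\<close> into \<open>r (K + c\<^sub>1)\<close>, so \<open>K\<close> lies in a translate of \<open>- r K\<close>.\<close>

lemma minkowski_asymmetry_le_ratio:
  assumes "symmetric_body C" "banach_mazur_position K C r"
  shows "minkowski_asymmetry K \<le> r"
proof -
  obtain c where c: "(\<lambda>x. x - c) ` C = uminus ` (\<lambda>x. x - c) ` C"
    using assms(1) by (auto simp: symmetric_body_def)
  obtain A c1 c2 where r: "0 \<le> r"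
    and sub: "(+) c1 ` K \<subseteq> (+) c2 ` (*v) A ` C"
    and sup: "(+) c2 ` (*v) A ` C \<subseteq> (*\<^sub>R) r ` (+) c1 ` K"
    using assms(2) by (auto simp: banach_mazur_position_def)
  have reflect: "2 *\<^sub>R c - y \<in> C" if "y \<in> C" for y
  proof -
    have "y - c \<in> uminus ` (\<lambda>x. x - c) ` C" using c that by blast
    then obtain z where "z \<in> C" "y - c = - (z - c)" by auto
    then have "2 *\<^sub>R c - y = z" by (simp add: scaleR_2 algebra_simps)
    then show ?thesis using \<open>z \<in> C\<close> by simp
  qed
  \<comment> \<open>Twice the center of \<open>D\<close>, minus the translation parts of the two copies of \<open>K + c\<^sub>1\<close>.\<close>
  define d where "d = 2 *\<^sub>R c2 + A *v (2 *\<^sub>R c) - c1 - r *\<^sub>R c1"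
  have "K \<subseteq> (+) d ` (*\<^sub>R) r ` uminus ` K"
  proof
    fix k assume "k \<in> K"
    then have "c1 + k \<in> (+) c2 ` (*v) A ` C" using sub by blast
    then obtain y where y: "y \<in> C" "c1 + k = c2 + A *v y" by auto
    have "c2 + A *v (2 *\<^sub>R c - y) \<in> (*\<^sub>R) r ` (+) c1 ` K"
      using sup reflect [OF y(1)] by blast
    then obtain k' where k': "k' \<in> K" "c2 + A *v (2 *\<^sub>R c - y) = r *\<^sub>R (c1 + k')" by auto
    have "A *v (2 *\<^sub>R c - y) = A *v (2 *\<^sub>R c) - A *v y"
      by (rule matrix_vector_mult_diff_distrib)
    then have "r *\<^sub>R k' = c2 + (A *v (2 *\<^sub>R c) - A *v y) - r *\<^sub>R c1"
      using k'(2) by (simp add: scaleR_add_right)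
    moreover have "A *v y = c1 + k - c2" using y(2) by simp
    ultimately have "k = d + r *\<^sub>R (- k')"
      by (simp only: d_def scaleR_minus_right scaleR_2) (simp only: algebra_simps, simp)
    then show "k \<in> (+) d ` (*\<^sub>R) r ` uminus ` K" using k'(1) by blast
  qed
  then show ?thesis
    unfolding minkowski_asymmetry_def circumradius_def
    using r by (intro cInf_lower bdd_belowI [of _ 0]) auto
qed

lemma bodies0_uminus:
  assumes "K \<in> bodies0"
  shows "uminus ` K \<in> bodies0"
  using assms
  by (auto simp: bodies0_def convex_negations interior_negations intro: compact_negations)

lemma minkowski_asymmetry_nonneg:
  assumes "K \<in> bodies0"
  shows "0 \<le> minkowski_asymmetry K"
proof -
  have "bounded K" using assms by (auto simp: bodies0_def compact_imp_bounded)
  then obtain r where r: "0 < r" "K \<subseteq> (*\<^sub>R) r ` uminus ` K"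
    using bounded_subset_scaled_body [OF bodies0_uminus [OF assms]] by blast
  then have "0 \<le> r \<and> (\<exists>c. K \<subseteq> (+) c ` (*\<^sub>R) r ` uminus ` K)"
    by (intro conjI exI [of _ 0]) auto
  then show ?thesis unfolding minkowski_asymmetry_def circumradius_def by (intro cInf_greatest) auto
qed

lemma max_covering_radius_uminus_le:
  assumes "K \<in> bodies0" "minkowski_centered K"
  shows "max_covering_radius K (uminus ` K) \<le> minkowski_asymmetry K"
proof -
  define s where "s = minkowski_asymmetry K"
  have s: "0 \<le> s" unfolding s_def using minkowski_asymmetry_nonneg assms by blast
  have K: "K \<subseteq> (*\<^sub>R) (- s) ` K" using assms by (simp add: minkowski_centered_def s_def)
  have "K \<subseteq> (*\<^sub>R) s ` uminus ` K"
    using K by (simp add: image_image)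
  moreover have "uminus ` K \<subseteq> (*\<^sub>R) s ` K"
    using K by force
  ultimately show ?thesis
    using s by (simp add: max_covering_radius_def covering_radius_le flip: s_def)
qed

theorem corollary7p1:
  fixes p :: ereal and K L C :: "(real ^ 'n) set"
  assumes "K \<in> bodies0" and "L \<in> bodies0" and "C \<in> bodies0"
    and "lower_mean p K L \<subseteq> C" and "C \<subseteq> upper_mean p K L"
  shows "banach_mazur K C \<le> max_covering_radius K L \<and>
    (minkowski_centered K \<and> L = uminus ` K \<and> symmetric_body C \<longrightarrow>
       banach_mazur K C = minkowski_asymmetry K)"
proof (intro conjI impI)
  note pos = banach_mazur_position_between_means [OF assms]
  show le: "banach_mazur K C \<le> max_covering_radius K L"
    by (rule dense_ge) (intro banach_mazur_le pos)
  assume A: "minkowski_centered K \<and> L = uminus ` K \<and> symmetric_body C"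
  show "banach_mazur K C = minkowski_asymmetry K"
  proof (rule antisym)
    show "banach_mazur K C \<le> minkowski_asymmetry K"
      using le max_covering_radius_uminus_le [OF assms(1)] A by force
    have "{r. banach_mazur_position K C r} \<noteq> {}"
      using pos [of "max_covering_radius K L + 1"] by auto
    then show "minkowski_asymmetry K \<le> banach_mazur K C"
      unfolding banach_mazur_eq_Inf
      using A by (intro cInf_greatest) (auto intro: minkowski_asymmetry_le_ratio)
  qed
qed

end
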